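(* Let $a,b,c,d$ be integers with $\gcd(a,b,c)=1$, $d\ge 1$ and $a^2+b^2+c^2=3d^2$, and let $\pi=\{(\alpha,\beta,\gamma)\in\mathbb{R}^3: a\alpha+b\beta+c\gamma=0\}$ (a plane through the origin $O$ with normal vector $(a,b,c)$). Let $P=(u,v,w)\in\pi$ with $u,v,w\in\mathbb{Q}$. Then a point $Q=(x,y,z)\in\pi$ satisfies $|OQ|=|PQ|=|OP|$ (i.e. $OPQ$ is equilateral) if and only if, for one common choice of sign $\pm$, $$x=\frac{u}{2}\pm\frac{cv-bw}{2d},\qquad y=\frac{v}{2}\pm\frac{aw-cu}{2d},\qquad z=\frac{w}{2}\pm\frac{bu-av}{2d}.$$ In particular all such points $Q$ have rational coordinates. *)

theory Defs
  imports "HOL-Analysis.Analysis"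
begin

definition plane_through_origin :: "int \<Rightarrow> int \<Rightarrow> int \<Rightarrow> (real ^ 3) set" where
  "plane_through_origin a b c =
     {p. real_of_int a * p $ 1 + real_of_int b * p $ 2 + real_of_int c * p $ 3 = 0}"

text \<open>The degenerate case where all three points coincide is not excluded.\<close>

definition equilateral :: "real ^ 3 \<Rightarrow> real ^ 3 \<Rightarrow> real ^ 3 \<Rightarrow> bool" where
  "equilateral A P Q \<longleftrightarrow> dist A Q = dist P Q \<and> dist P Q = dist A P"

end

theory Submission
  imports Defs
begin

text \<open>
  Let \<open>n = (a, b, c)\<close> and \<open>R = Q - P/2\<close>. The triangle \<open>OPQ\<close> is equilateral iff \<open>R \<bullet> P = 0\<close> and
  \<open>4 |R|\<^sup>2 = 3 |P|\<^sup>2\<close>. Since \<open>R\<close> is orthogonal to both \<open>P\<close> and \<open>n\<close>, it is parallel to \<open>P \<times> n\<close>,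
  whose squared length is \<open>3 d\<^sup>2 |P|\<^sup>2 = (2 d |R|)\<^sup>2\<close>; hence \<open>2 d R = \<plusminus> (P \<times> n)\<close>.
\<close>

unbundle cross3_syntax

text \<open>By Lagrange's identity \<open>norm_cross_dot\<close>, a vanishing cross product gives
  equality in Cauchy-Schwarz. With equal norms the inner product of \<open>x\<close> and
  \<open>y\<close> is thus plus or minus the squared norm of \<open>y\<close>, so
  \<open>x - y\<close> or \<open>x + y\<close> has length zero.\<close>

lemma parallel_eq_norm_imp_eq_or_neg:
  fixes x y :: "real ^ 3"
  assumes "x \<times> y = 0" and "norm x = norm y"
  shows "x = y \<or> x = - y"
proof -
  have "(x \<bullet> y)\<^sup>2 = (y \<bullet> y)\<^sup>2"
    using norm_cross_dot[of x y] assms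
    by (simp add: power2_norm_eq_inner flip: power2_eq_square)
  moreover have "x \<bullet> x = y \<bullet> y"
    using assms(2) by (simp add: norm_eq)
  ultimately have "(x - y) \<bullet> (x - y) = 0 \<or> (x + y) \<bullet> (x + y) = 0"
    by (auto simp: power2_eq_iff inner_diff_left inner_diff_right inner_add_left inner_add_right
        inner_commute[of y x])
  then show ?thesis
    by (auto simp: eq_neg_iff_add_eq_0)
qed

text \<open>Orthogonality says that \<open>q\<close> lies on the perpendicular bisector of the
  segment from 0 to \<open>p\<close>. Given this, Pythagoras at the midpoint turns |q| = |p| into
  the condition on the altitude.\<close>

lemma dist_0_equilateral_iff:
  fixes p q :: "'a :: real_inner"
  shows "dist 0 q = dist p q \<and> dist p q = dist 0 p \<longleftrightarrow>
    (q - p /\<^sub>R 2) \<bullet> p = 0 \<and> 4 * ((q - p /\<^sub>R 2) \<bullet> (q - p /\<^sub>R 2)) = 3 * (p \<bullet> p)"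
  by (auto simp: dist_norm norm_eq inner_diff_left inner_diff_right inner_commute[of q p] field_simps)

lemma equilateral_0_iff_cross3:
  fixes n p q :: "real ^ 3" and d :: real
  assumes "n \<bullet> p = 0" and "n \<bullet> q = 0" and "n \<bullet> n = 3 * d\<^sup>2" and "d > 0"
  shows "equilateral 0 p q \<longleftrightarrow> (\<exists>s \<in> {1, -1}. q = p /\<^sub>R 2 + (s / (2 * d)) *\<^sub>R (p \<times> n))"
proof -
  define r m where "r = q - p /\<^sub>R 2" and "m = p \<times> n"
  have rn: "r \<bullet> n = 0"
    using assms by (simp add: r_def inner_diff_left inner_commute[of p n] inner_commute[of q n])
  have mm: "m \<bullet> m = 3 * d\<^sup>2 * (p \<bullet> p)"
    using norm_cross_dot[of p n] assms
    by (simp add: m_def power_mult_distrib power2_norm_eq_inner inner_commute)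
  have mp: "m \<bullet> p = 0"
    by (simp add: m_def dot_cross_self)
  have "equilateral 0 p q \<longleftrightarrow> r \<bullet> p = 0 \<and> 4 * (r \<bullet> r) = 3 * (p \<bullet> p)"
    unfolding equilateral_def r_def by (rule dist_0_equilateral_iff)
  also have "\<dots> \<longleftrightarrow> (2 * d) *\<^sub>R r = m \<or> (2 * d) *\<^sub>R r = - m"
  proof
    assume *: "r \<bullet> p = 0 \<and> 4 * (r \<bullet> r) = 3 * (p \<bullet> p)"
    show "(2 * d) *\<^sub>R r = m \<or> (2 * d) *\<^sub>R r = - m"
    \<comment> \<open>The degenerate case \<open>p = 0\<close> is covered too: then
      \<open>m = 0\<close>.\<close>
    proof (rule parallel_eq_norm_imp_eq_or_neg)
      \<comment> \<open>The triple product r x (p x n) expands to (r.n) p - (r.p) n, and both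
        coefficients vanish.\<close>
      show "((2 * d) *\<^sub>R r) \<times> m = 0"
        using * rn by (simp add: m_def cross_mult_left Lagrange)
      show "norm ((2 * d) *\<^sub>R r) = norm m"
        unfolding norm_eq using * mm by (simp add: power2_eq_square)
    qed
  next
    assume *: "(2 * d) *\<^sub>R r = m \<or> (2 * d) *\<^sub>R r = - m"
    \<comment> \<open>Neither equation sees the sign of \<open>m\<close>, so both cases are treated
      at once. The scaling rules are switched off so that \<open>*\<close> can rewrite the scaled
      vector as a whole.\<close>
    then have "((2 * d) *\<^sub>R r) \<bullet> p = 0" "((2 * d) *\<^sub>R r) \<bullet> ((2 * d) *\<^sub>R r) = m \<bullet> m"
      using mp by (auto simp del: inner_scaleR_left inner_scaleR_right)
    then show "r \<bullet> p = 0 \<and> 4 * (r \<bullet> r) = 3 * (p \<bullet> p)"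
      using mm \<open>d > 0\<close> by (simp add: power2_eq_square)
  qed
  also have "\<dots> \<longleftrightarrow> (\<exists>s \<in> {1, -1}. r = (s / (2 * d)) *\<^sub>R m)"
  proof -
    have "(2 * d) *\<^sub>R r = s *\<^sub>R m \<longleftrightarrow> r = (s / (2 * d)) *\<^sub>R m" for s
      using \<open>d > 0\<close> scaleR_cancel_left[of "2 * d" r "(s / (2 * d)) *\<^sub>R m"] by simp
    from this[of 1] this[of "-1"] show ?thesis
      by simp
  qed
  finally show ?thesis
    by (simp add: r_def m_def algebra_simps)
qed

theorem theorem2p3:
  fixes a b c d :: int and u v w x y z :: real
  assumes "gcd a (gcd b c) = 1"
    and "d \<ge> 1"
    and "a\<^sup>2 + b\<^sup>2 + c\<^sup>2 = 3 * d\<^sup>2"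
    and "u \<in> \<rat>" and "v \<in> \<rat>" and "w \<in> \<rat>"
    and "vector [u, v, w] \<in> plane_through_origin a b c"
    and "vector [x, y, z] \<in> plane_through_origin a b c"
  shows "(equilateral 0 (vector [u, v, w]) (vector [x, y, z]) \<longleftrightarrow>
            (\<exists>s \<in> {1, -1}.
               x = u / 2 + s * ((of_int c * v - of_int b * w) / (2 * of_int d)) \<and>
               y = v / 2 + s * ((of_int a * w - of_int c * u) / (2 * of_int d)) \<and>
               z = w / 2 + s * ((of_int b * u - of_int a * v) / (2 * of_int d)))) \<and>
         (equilateral 0 (vector [u, v, w]) (vector [x, y, z]) \<longrightarrow>
            x \<in> \<rat> \<and> y \<in> \<rat> \<and> z \<in> \<rat>)"
proof -
  define n p q :: "real ^ 3"
    where "n = vector [of_int a, of_int b, of_int c]"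
      and "p = vector [u, v, w]" and "q = vector [x, y, z]"
  have "real_of_int (a\<^sup>2 + b\<^sup>2 + c\<^sup>2) = real_of_int (3 * d\<^sup>2)"
    using assms(3) by (rule arg_cong)
  then have "n \<bullet> n = 3 * (of_int d)\<^sup>2"
    by (simp add: n_def inner_vec_def sum_3 power2_eq_square)
  moreover have "n \<bullet> p = 0" "n \<bullet> q = 0"
    using assms(7,8) by (simp_all add: n_def p_def q_def plane_through_origin_def inner_vec_def sum_3)
  ultimately have "equilateral 0 p q \<longleftrightarrow>
      (\<exists>s \<in> {1, -1}. q = p /\<^sub>R 2 + (s / (2 * of_int d)) *\<^sub>R (p \<times> n))"
    using \<open>d \<ge> 1\<close> by (intro equilateral_0_iff_cross3) simp_all
  \<comment> \<open>The coordinates of p x n are cv - bw, aw - cu, bu - av; this order of the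
    factors matches the signs in the claim.\<close>
  also have "\<dots> \<longleftrightarrow> (\<exists>s \<in> {1, -1}.
               x = u / 2 + s * ((of_int c * v - of_int b * w) / (2 * of_int d)) \<and>
               y = v / 2 + s * ((of_int a * w - of_int c * u) / (2 * of_int d)) \<and>
               z = w / 2 + s * ((of_int b * u - of_int a * v) / (2 * of_int d)))"
    by (simp add: n_def p_def q_def vec_eq_iff forall_3 cross3_def mult.commute)
  finally have iff: "equilateral 0 p q \<longleftrightarrow> \<dots>" .
  \<comment> \<open>For either sign, the formulas combine rationals and integers by field operations
    only.\<close>
  then have "x \<in> \<rat> \<and> y \<in> \<rat> \<and> z \<in> \<rat>" if "equilateral 0 p q"
    using that assms(4-6) by auto
  with iff show ?thesis
    unfolding p_def q_def by blast
qed

end
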